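(* Let $0 \le p \le q \le r < \infty$ and $1 \le r < a < \infty$, let $\sigma > 0$, let $V$ be a real Banach space, and let $A : \ell_r \to V$ be an injective bounded non-compact linear operator with non-closed range such that, for some constants $0 < d_1 \le d_2 < \infty$, $$ d_1 \|u\|_a \le \|Au\|_V \le d_2 \|u\|_a \qquad (u \in \ell_r). $$ Let $u^\dagger \in \ell_q$ and $v := A u^\dagger$. For each $\delta > 0$ let $v^\delta \in V$ satisfy $\|v^\delta - v\|_V \le \delta$, put $$ \alpha_\delta := \delta^{\sigma + \frac{(q-p)a}{a-q}}, $$ and let $u_{\alpha_\delta}^\delta \in \ell_p$ be a minimizer over $\ell_r$ of the Tikhonov functional $T_\alpha^\delta(u) = \|Au - v^\delta\|_V^\sigma + \alpha\, \mathcal{R}_p(u)$ with $\alpha = \alpha_\delta$. Then $$ \|u_{\alpha_\delta}^\delta - u^\dagger\|_r = \mathcal{O}(\delta^{\gamma_1}), \qquad \mathcal{R}_p(u_{\alpha_\delta}^\delta) = \mathcal{O}(\delta^{-\gamma_2}) \qquad \text{as } \delta \to 0, $$ where $$ \gamma_1 = \frac{a}{r} \cdot \frac{r-q}{a-q}, \qquad \gamma_2 = \frac{(q-p)a}{a-q}. $$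
   Context: All sequences are real and indexed by $k = 1,2,\ldots$. For $0 < s < \infty$, $\|u\|_s := (\sum_{k=1}^\infty |u_k|^s)^{1/s}$ and $\ell_s := \{u = (u_k)_{k\ge1} : \|u\|_s < \infty\}$ (a Banach space for $s \ge 1$, a quasi-normed space for $0<s<1$). For $s = 0$, $\|u\|_0 := \#\{k \in \mathbb{N} : u_k \ne 0\}$ and $\ell_0 := \{u : \|u\|_0 < \infty\}$. One has $\ell_p \subset \ell_q \subset \ell_r \subset \ell_a$ for $0 \le p \le q \le r < a$. The penalty functional is $\mathcal{R}_p(u) := \|u\|_p^p$ for $p > 0$ and $\mathcal{R}_0(u) := \|u\|_0$; it takes the value $+\infty$ for $u \notin \ell_p$, so $T_\alpha^\delta(u)$ is finite if and only if $u \in \ell_p$. *)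

theory Defs
  imports "HOL-Analysis.Analysis" "HOL-Library.Landau_Symbols"
begin

text \<open>A real sequence is a function \<open>nat \<Rightarrow> real\<close>; the entries are numbered from 0 instead of 1.
  Norms and penalties live in the extended nonnegative reals, so that they are defined for every
  sequence.\<close>

definition enn_powr :: "ennreal \<Rightarrow> real \<Rightarrow> ennreal" where
  \<comment> \<open>only meant for positive exponents\<close>
  "enn_powr x s = (if x = top then top else ennreal (enn2real x powr s))"

definition ell_norm :: "real \<Rightarrow> (nat \<Rightarrow> real) \<Rightarrow> ennreal" where
  "ell_norm s u =
     (if s = 0 then emeasure (count_space UNIV) {k. u k \<noteq> 0}
      else enn_powr (\<Sum>k. ennreal (\<bar>u k\<bar> powr s)) (1 / s))"

definition ell :: "real \<Rightarrow> (nat \<Rightarrow> real) set" where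
  "ell s = {u. ell_norm s u < top}"

definition penalty :: "real \<Rightarrow> (nat \<Rightarrow> real) \<Rightarrow> ennreal" where
  "penalty p u = (if p = 0 then ell_norm 0 u else enn_powr (ell_norm p u) p)"

definition linear_on_ell :: "real \<Rightarrow> ((nat \<Rightarrow> real) \<Rightarrow> 'v::real_vector) \<Rightarrow> bool" where
  "linear_on_ell r A \<longleftrightarrow>
     (\<forall>u\<in>ell r. \<forall>w\<in>ell r. A (\<lambda>k. u k + w k) = A u + A w) \<and>
     (\<forall>c. \<forall>u\<in>ell r. A (\<lambda>k. c * u k) = c *\<^sub>R A u)"

definition bounded_on_ell :: "real \<Rightarrow> ((nat \<Rightarrow> real) \<Rightarrow> 'v::real_normed_vector) \<Rightarrow> bool" where
  "bounded_on_ell r A \<longleftrightarrow>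
     (\<exists>C::real. \<forall>u\<in>ell r. ennreal (norm (A u)) \<le> ennreal C * ell_norm r u)"

definition compact_on_ell :: "real \<Rightarrow> ((nat \<Rightarrow> real) \<Rightarrow> 'v::real_normed_vector) \<Rightarrow> bool" where
  "compact_on_ell r A \<longleftrightarrow> compact (closure (A ` {u \<in> ell r. ell_norm r u \<le> 1}))"

definition tikhonov ::
  "((nat \<Rightarrow> real) \<Rightarrow> 'v::real_normed_vector) \<Rightarrow> 'v \<Rightarrow> real \<Rightarrow> real \<Rightarrow> real \<Rightarrow> (nat \<Rightarrow> real) \<Rightarrow> ennreal"
where
  "tikhonov A w \<sigma> p \<alpha> u = ennreal (norm (A u - w) powr \<sigma>) + ennreal \<alpha> * penalty p u"


text \<open>The following facts show that \<open>enn2real\<close> may be applied to \<open>penalty p u\<close> for \<open>u \<in> ell p\<close>,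
  and to \<open>ell_norm r (u - w)\<close> for \<open>u \<in> ell p\<close>, \<open>w \<in> ell q\<close> with \<open>p, q \<le> r\<close>, without losing
  information.\<close>

lemma penalty_finite_iff: "penalty p u < top \<longleftrightarrow> u \<in> ell p"
  by (auto simp: penalty_def ell_def enn_powr_def less_top[symmetric])

lemma penalty_pos_eq:
  assumes "p > 0"
  shows "penalty p u = (\<Sum>k. ennreal (\<bar>u k\<bar> powr p))"
  using assms
  by (auto simp: penalty_def ell_norm_def enn_powr_def powr_powr ennreal_enn2real_if)

lemma mem_ell_0: "u \<in> ell 0 \<longleftrightarrow> finite {k. u k \<noteq> 0}"
  by (auto simp: ell_def ell_norm_def less_top[symmetric] emeasure_count_space)

lemma mem_ell_pos:
  assumes "s > 0"
  shows "u \<in> ell s \<longleftrightarrow> summable (\<lambda>k. \<bar>u k\<bar> powr s)"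
proof -
  have "u \<in> ell s \<longleftrightarrow> (\<Sum>k. ennreal (\<bar>u k\<bar> powr s)) \<noteq> top"
    using assms by (auto simp: ell_def ell_norm_def enn_powr_def less_top[symmetric])
  also have "\<dots> \<longleftrightarrow> summable (\<lambda>k. \<bar>u k\<bar> powr s)"
    by (auto intro: summable_suminf_not_top simp: suminf_ennreal2)
  finally show ?thesis .
qed

lemma ell_mono:
  assumes "0 \<le> p" "p \<le> q"
  shows "ell p \<subseteq> ell q"
proof
  fix u assume u: "u \<in> ell p"
  consider "q = p" | "p = 0" "q > 0" | "0 < p" "q > 0"
    using assms by linarith
  then show "u \<in> ell q"
  proof cases
    case 1
    then show ?thesis using u by simp
  next
    case 2
    then have "summable (\<lambda>k. \<bar>u k\<bar> powr q)"
      using u by (intro summable_finite[of "{k. u k \<noteq> 0}"]) (auto simp: mem_ell_0)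
    then show ?thesis using 2 by (simp add: mem_ell_pos)
  next
    case 3
    then have s: "summable (\<lambda>k. \<bar>u k\<bar> powr p)"
      using u by (simp add: mem_ell_pos)
    then have "(\<lambda>k. \<bar>u k\<bar> powr p) \<longlonglongrightarrow> 0"
      by (rule summable_LIMSEQ_zero)
    then have "\<forall>\<^sub>F k in sequentially. \<bar>u k\<bar> powr p < 1"
      by (rule order_tendstoD) simp
    then have "\<forall>\<^sub>F k in sequentially. norm (\<bar>u k\<bar> powr q) \<le> \<bar>u k\<bar> powr p"
    proof eventually_elim
      case (elim k)
      then have "\<bar>u k\<bar> \<le> 1"
        using 3 by (smt (verit) ge_one_powr_ge_zero)
      then show ?case
        using assms by (cases "u k = 0") (auto intro: powr_mono')
    qed
    then have "summable (\<lambda>k. \<bar>u k\<bar> powr q)"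
      using s by (rule summable_comparison_test_ev)
    then show ?thesis using 3 by (simp add: mem_ell_pos)
  qed
qed

lemma ell_diff:
  assumes "s \<ge> 0" "u \<in> ell s" "w \<in> ell s"
  shows "(\<lambda>k. u k - w k) \<in> ell s"
proof (cases "s = 0")
  case True
  have "{k. u k - w k \<noteq> 0} \<subseteq> {k. u k \<noteq> 0} \<union> {k. w k \<noteq> 0}"
    by auto
  then show ?thesis
    using assms True by (auto simp: mem_ell_0 intro: finite_subset)
next
  case False
  then have s: "s > 0" using assms by simp
  have "summable (\<lambda>k. 2 powr s * (\<bar>u k\<bar> powr s + \<bar>w k\<bar> powr s))"
    using assms s by (auto simp: mem_ell_pos intro!: summable_mult summable_add)
  moreover have "norm (\<bar>u k - w k\<bar> powr s) \<le> 2 powr s * (\<bar>u k\<bar> powr s + \<bar>w k\<bar> powr s)" for k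
  proof -
    let ?m = "max \<bar>u k\<bar> \<bar>w k\<bar>"
    have "\<bar>u k - w k\<bar> powr s \<le> (2 * ?m) powr s"
      using s by (intro powr_mono2) auto
    also have "\<dots> = 2 powr s * ?m powr s"
      by (simp add: powr_mult)
    also have "?m powr s \<le> \<bar>u k\<bar> powr s + \<bar>w k\<bar> powr s"
      by (simp add: max_def)
    finally show ?thesis by (simp add: mult_left_mono)
  qed
  ultimately have "summable (\<lambda>k. \<bar>u k - w k\<bar> powr s)"
    by (rule summable_comparison_test'[where N = 0])
  then show ?thesis using s by (simp add: mem_ell_pos)
qed

end

theory Submission
  imports Defs
begin

text \<open>Compare the minimizer with the truncation of \<open>udag\<close> at height \<open>t = \<delta> powr (a / (a - q))\<close>.
  This truncation has distance \<open>O(\<delta>)\<close> to \<open>udag\<close> in the \<open>a\<close>-norm and penalty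
  \<open>O(t powr (p - q))\<close>, so its Tikhonov value is \<open>O(\<delta> powr \<sigma>)\<close>. By minimality, \<open>u\<delta> \<delta>\<close> obeys
  bounds of the same orders. The rate in the \<open>r\<close>-norm then follows from the interpolation
  inequality \<open>power_diff_split\<close>, applied entrywise with the same \<open>t\<close> to \<open>u\<delta> \<delta>\<close> and \<open>udag\<close>.\<close>

subsection \<open>Power sums\<close>

text \<open>As \<open>x powr 0\<close> is \<open>1\<close> for \<open>x \<noteq> 0\<close> and \<open>0\<close> for \<open>x = 0\<close>, the power sum with exponent \<open>0\<close>
  counts the nonzero entries, so no separate treatment of \<open>s = 0\<close> is needed below.\<close>

lemma mem_ell_iff_summable:
  assumes "s \<ge> 0"
  shows "u \<in> ell s \<longleftrightarrow> summable (\<lambda>k. \<bar>u k\<bar> powr s)"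
proof (cases "s = 0")
  case True
  have "finite {k. u k \<noteq> 0}" if s: "summable (\<lambda>k. \<bar>u k\<bar> powr 0)"
  proof -
    \<comment> \<open>Every term is 0 or 1, so convergence to 0 makes all but finitely many of them
      vanish.\<close>
    have "(\<lambda>k. \<bar>u k\<bar> powr 0) \<longlonglongrightarrow> 0"
      using s by (rule summable_LIMSEQ_zero)
    then have "\<forall>\<^sub>F k in sequentially. \<bar>u k\<bar> powr 0 < 1"
      by (rule order_tendstoD) simp
    then have "\<forall>\<^sub>F k in cofinite. u k = 0"
      unfolding cofinite_eq_sequentially by eventually_elim (simp split: if_splits)
    then show ?thesis
      by (simp add: eventually_cofinite)
  qed
  moreover have "summable (\<lambda>k. \<bar>u k\<bar> powr 0)" if "finite {k. u k \<noteq> 0}"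
    by (rule summable_finite[OF that]) auto
  ultimately show ?thesis
    using True by (auto simp: mem_ell_0)
next
  case False
  then show ?thesis
    using assms by (simp add: mem_ell_pos)
qed

lemma penalty_eq_suminf:
  assumes "s \<ge> 0" "u \<in> ell s"
  shows "penalty s u = ennreal (\<Sum>k. \<bar>u k\<bar> powr s)"
proof (cases "s = 0")
  case True
  have fin: "finite {k. u k \<noteq> 0}"
    using assms True by (simp add: mem_ell_0)
  have "(\<Sum>k. \<bar>u k\<bar> powr 0) = (\<Sum>k\<in>{k. u k \<noteq> 0}. \<bar>u k\<bar> powr 0)"
    by (rule suminf_finite[OF fin]) auto
  also have "\<dots> = real (card {k. u k \<noteq> 0})"
    by simp
  finally show ?thesis
    using True fin by (simp add: penalty_def ell_norm_def ennreal_of_nat_eq_real_of_nat)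
next
  case False
  then show ?thesis
    using assms by (simp add: penalty_pos_eq mem_ell_pos suminf_ennreal2)
qed

lemma ell_norm_eq_suminf:
  assumes "s > 0" "u \<in> ell s"
  shows "ell_norm s u = ennreal ((\<Sum>k. \<bar>u k\<bar> powr s) powr (1 / s))"
proof -
  have s: "summable (\<lambda>k. \<bar>u k\<bar> powr s)"
    using assms by (simp add: mem_ell_pos)
  then have "(\<Sum>k. ennreal (\<bar>u k\<bar> powr s)) = ennreal (\<Sum>k. \<bar>u k\<bar> powr s)"
    by (intro suminf_ennreal2) auto
  then show ?thesis
    using assms suminf_nonneg[OF s] by (simp add: ell_norm_def enn_powr_def)
qed

lemma linear_on_ell_diff:
  assumes "linear_on_ell s A" "s \<ge> 0" "u \<in> ell s" "w \<in> ell s"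
  shows "A (\<lambda>k. u k - w k) = A u - A w"
proof -
  have "A (\<lambda>k. (u k - w k) + w k) = A (\<lambda>k. u k - w k) + A w"
    using assms ell_diff[of s u w] unfolding linear_on_ell_def by fast
  then show ?thesis by simp
qed

text \<open>Serves both truncation estimates, where the entrywise bound is all that has to be
  checked.\<close>

lemma summable_suminf_le:
  fixes f g :: "nat \<Rightarrow> real"
  assumes "summable g" "\<And>k. 0 \<le> f k" "\<And>k. f k \<le> c * g k"
  shows "summable f" "suminf f \<le> c * suminf g"
proof -
  have s: "summable (\<lambda>k. c * g k)"
    using assms(1) by (rule summable_mult)
  show f: "summable f"
    by (rule summable_comparison_test'[OF s, of 0]) (use assms in auto)
  show "suminf f \<le> c * suminf g"
    using suminf_le[OF assms(3) f s] suminf_mult[OF assms(1), of c] by simp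
qed

subsection \<open>Truncation\<close>

text \<open>In \<open>x powr r = x powr (r - s) * x powr s\<close> the first factor has a
  nonnegative exponent, so it is largest at \<open>x = t\<close>.\<close>

lemma powr_le_powr_diff_mult:
  fixes x t :: real
  assumes "0 \<le> x" "x \<le> t" "s \<le> r"
  shows "x powr r \<le> t powr (r - s) * x powr s"
proof (cases "x = 0")
  case False
  have "x powr r = x powr (r - s) * x powr s"
    by (simp flip: powr_add)
  also have "\<dots> \<le> t powr (r - s) * x powr s"
    using assms by (intro mult_right_mono powr_mono2) auto
  finally show ?thesis .
qed simp

text \<open>Counterpart above the threshold: now \<open>r - s\<close> is at most 0, so
  \<open>x powr (r - s)\<close> decreases and is again largest at \<open>t\<close>.\<close>

lemma powr_le_powr_diff_mult':
  fixes x t :: real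
  assumes "0 < t" "t \<le> x" "r \<le> s"
  shows "x powr r \<le> t powr (r - s) * x powr s"
proof -
  have "x powr r = x powr (r - s) * x powr s"
    by (simp flip: powr_add)
  also have "\<dots> \<le> t powr (r - s) * x powr s"
    using assms by (intro mult_right_mono powr_mono2') auto
  finally show ?thesis .
qed

text \<open>Hard thresholding. For \<open>t > 0\<close> and \<open>u\<close> in some
  \<open>ell q\<close> with \<open>q \<ge> 0\<close> only finitely many entries survive.\<close>

definition truncate_below :: "real \<Rightarrow> (nat \<Rightarrow> real) \<Rightarrow> nat \<Rightarrow> real" where
  "truncate_below t u k = (if \<bar>u k\<bar> > t then u k else 0)"

text \<open>Surviving entries exceed \<open>t\<close>, so lowering the exponent from
  \<open>q\<close> to \<open>p\<close> costs a factor \<open>t powr (p - q)\<close>. For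
  \<open>p = 0\<close> this is Markov's inequality for the counting measure.\<close>

lemma truncate_below_power_sum:
  assumes "0 < t" "0 \<le> p" "p \<le> q" "u \<in> ell q"
  shows "truncate_below t u \<in> ell p"
    and "(\<Sum>k. \<bar>truncate_below t u k\<bar> powr p) \<le> t powr (p - q) * (\<Sum>k. \<bar>u k\<bar> powr q)"
proof -
  have "summable (\<lambda>k. \<bar>u k\<bar> powr q)"
    using assms by (simp add: mem_ell_iff_summable)
  moreover have "\<bar>truncate_below t u k\<bar> powr p \<le> t powr (p - q) * \<bar>u k\<bar> powr q" for k
    using powr_le_powr_diff_mult'[of t "\<bar>u k\<bar>" p q] assms by (simp add: truncate_below_def)
  ultimately show "truncate_below t u \<in> ell p"
    and "(\<Sum>k. \<bar>truncate_below t u k\<bar> powr p) \<le> t powr (p - q) * (\<Sum>k. \<bar>u k\<bar> powr q)"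
    using summable_suminf_le[of "\<lambda>k. \<bar>u k\<bar> powr q" "\<lambda>k. \<bar>truncate_below t u k\<bar> powr p" "t powr (p - q)"]
      assms
    by (auto simp: mem_ell_iff_summable)
qed

text \<open>The error consists of the removed entries. They are at most \<open>t\<close> in modulus,
  so raising the exponent from \<open>q\<close> to \<open>a\<close> gains
  \<open>t powr (a - q)\<close>.\<close>

lemma truncate_below_error:
  assumes "0 < t" "0 \<le> q" "q \<le> a" "u \<in> ell q"
  shows "(\<Sum>k. \<bar>truncate_below t u k - u k\<bar> powr a) \<le> t powr (a - q) * (\<Sum>k. \<bar>u k\<bar> powr q)"
proof (rule summable_suminf_le)
  show "summable (\<lambda>k. \<bar>u k\<bar> powr q)"
    using assms by (simp add: mem_ell_iff_summable)
  show "\<bar>truncate_below t u k - u k\<bar> powr a \<le> t powr (a - q) * \<bar>u k\<bar> powr q" for k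
    using powr_le_powr_diff_mult[of "\<bar>u k\<bar>" t q a] assms by (simp add: truncate_below_def)
qed auto

subsection \<open>Interpolation\<close>

text \<open>A difference of at least \<open>t\<close> is absorbed by its \<open>a\<close>-th power.
  A smaller one is at most twice the larger of \<open>\<bar>x\<bar>\<close> and
  \<open>\<bar>y\<bar>\<close>, and is charged to that entry with its own exponent.\<close>

lemma power_diff_split:
  fixes x y t :: real
  assumes "0 < t" "0 \<le> p" "p \<le> r" "0 \<le> q" "q \<le> r" "r \<le> a"
  shows "\<bar>x - y\<bar> powr r \<le> t powr (r - a) * \<bar>x - y\<bar> powr a
           + 2 powr p * t powr (r - p) * \<bar>x\<bar> powr p + 2 powr q * t powr (r - q) * \<bar>y\<bar> powr q"
    (is "?e powr r \<le> ?E + ?X + ?Y")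
proof -
  have nonneg: "0 \<le> ?E" "0 \<le> ?X" "0 \<le> ?Y"
    by simp_all
  \<comment> \<open>Here \<open>z\<close> is the dominating one of \<open>x\<close> and
    \<open>y\<close>. The exponent is lowered to \<open>s\<close> while the difference is below
    \<open>t\<close>; only then is \<open>2 * \<bar>z\<bar>\<close> inserted.\<close>
  have small: "?e powr r \<le> 2 powr s * t powr (r - s) * \<bar>z\<bar> powr s"
    if "?e \<le> t" "?e \<le> 2 * \<bar>z\<bar>" "0 \<le> s" "s \<le> r" for z s
  proof -
    have "?e powr r \<le> t powr (r - s) * ?e powr s"
      using that by (intro powr_le_powr_diff_mult) auto
    also have "\<dots> \<le> t powr (r - s) * (2 * \<bar>z\<bar>) powr s"
      using that by (intro mult_left_mono powr_mono2) auto
    finally show ?thesis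
      by (simp add: powr_mult mult_ac)
  qed
  consider "t \<le> ?e" | "?e \<le> t" "\<bar>y\<bar> \<le> \<bar>x\<bar>" | "?e \<le> t" "\<bar>x\<bar> \<le> \<bar>y\<bar>"
    by linarith
  then show ?thesis
  proof cases
    case 1
    then show ?thesis
      using powr_le_powr_diff_mult'[of t ?e r a] assms nonneg by linarith
  next
    case 2
    then show ?thesis
      using small[of x p] assms nonneg by linarith
  next
    case 3
    then show ?thesis
      using small[of y q] assms nonneg by linarith
  qed
qed

text \<open>\<open>power_diff_split\<close> is summed over the entries. The series of differences
  converge because \<open>u\<close> and \<open>w\<close> lie in \<open>ell r\<close>, which is
  contained in \<open>ell a\<close>.\<close>

lemma power_sum_diff_split:
  assumes "0 < t" "0 \<le> p" "p \<le> r" "0 \<le> q" "q \<le> r" "r \<le> a"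
    and u: "u \<in> ell p" and w: "w \<in> ell q"
  shows "(\<Sum>k. \<bar>u k - w k\<bar> powr r) \<le> t powr (r - a) * (\<Sum>k. \<bar>u k - w k\<bar> powr a)
           + 2 powr p * t powr (r - p) * (\<Sum>k. \<bar>u k\<bar> powr p)
           + 2 powr q * t powr (r - q) * (\<Sum>k. \<bar>w k\<bar> powr q)"
proof -
  have "u \<in> ell r" "w \<in> ell r"
    using assms ell_mono[of p r] ell_mono[of q r] by auto
  then have er: "(\<lambda>k. u k - w k) \<in> ell r"
    using assms by (intro ell_diff) auto
  then have "(\<lambda>k. u k - w k) \<in> ell a"
    using assms ell_mono[of r a] by auto
  then have s: "summable (\<lambda>k. \<bar>u k - w k\<bar> powr r)" "summable (\<lambda>k. \<bar>u k - w k\<bar> powr a)"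
      "summable (\<lambda>k. \<bar>u k\<bar> powr p)" "summable (\<lambda>k. \<bar>w k\<bar> powr q)"
    using er u w assms by (simp_all add: mem_ell_iff_summable)
  have "(\<lambda>k. t powr (r - a) * \<bar>u k - w k\<bar> powr a + 2 powr p * t powr (r - p) * \<bar>u k\<bar> powr p
           + 2 powr q * t powr (r - q) * \<bar>w k\<bar> powr q)
        sums (t powr (r - a) * (\<Sum>k. \<bar>u k - w k\<bar> powr a)
           + 2 powr p * t powr (r - p) * (\<Sum>k. \<bar>u k\<bar> powr p)
           + 2 powr q * t powr (r - q) * (\<Sum>k. \<bar>w k\<bar> powr q))"
    using s by (intro sums_add sums_mult summable_sums)
  then show ?thesis
    by (rule sums_le[OF power_diff_split[OF assms(1-6)] summable_sums[OF s(1)]])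
qed

subsection \<open>Convergence rates\<close>

theorem theorem8:
  fixes p q r a \<sigma> d\<^sub>1 d\<^sub>2 \<gamma>\<^sub>1 \<gamma>\<^sub>2 :: real
    and A :: "(nat \<Rightarrow> real) \<Rightarrow> 'v::banach"
    and udag :: "nat \<Rightarrow> real"
    and v :: 'v
    and v\<delta> :: "real \<Rightarrow> 'v"
    and \<alpha> :: "real \<Rightarrow> real"
    and u\<delta> :: "real \<Rightarrow> nat \<Rightarrow> real"
  assumes "0 \<le> p" "p \<le> q" "q \<le> r" "1 \<le> r" "r < a" "\<sigma> > 0"
    and "linear_on_ell r A" "bounded_on_ell r A" "inj_on A (ell r)"
    and "\<not> compact_on_ell r A" "\<not> closed (A ` ell r)"
    and "0 < d\<^sub>1" "d\<^sub>1 \<le> d\<^sub>2"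
    and "\<And>u. u \<in> ell r \<Longrightarrow>
           ennreal d\<^sub>1 * ell_norm a u \<le> ennreal (norm (A u)) \<and>
           ennreal (norm (A u)) \<le> ennreal d\<^sub>2 * ell_norm a u"
    and "udag \<in> ell q" "v = A udag"
    and "\<And>\<delta>. \<delta> > 0 \<Longrightarrow> norm (v\<delta> \<delta> - v) \<le> \<delta>"
    and "\<And>\<delta>. \<delta> > 0 \<Longrightarrow> \<alpha> \<delta> = \<delta> powr (\<sigma> + (q - p) * a / (a - q))"
    and "\<And>\<delta>. \<delta> > 0 \<Longrightarrow> u\<delta> \<delta> \<in> ell p"
    and "\<And>\<delta>. \<delta> > 0 \<Longrightarrow>
           is_arg_min (tikhonov A (v\<delta> \<delta>) \<sigma> p (\<alpha> \<delta>)) (\<lambda>u. u \<in> ell r) (u\<delta> \<delta>)"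
    and "\<gamma>\<^sub>1 = a / r * ((r - q) / (a - q))"
    and "\<gamma>\<^sub>2 = (q - p) * a / (a - q)"
  shows "(\<lambda>\<delta>. enn2real (ell_norm r (\<lambda>k. u\<delta> \<delta> k - udag k))) \<in> O[at_right 0](\<lambda>\<delta>. \<delta> powr \<gamma>\<^sub>1) \<and>
         (\<lambda>\<delta>. enn2real (penalty p (u\<delta> \<delta>))) \<in> O[at_right 0](\<lambda>\<delta>. \<delta> powr (- \<gamma>\<^sub>2))"
proof -
  have q0: "0 \<le> q" and r0: "0 < r" and a0: "0 < a" and qa: "q < a" and pr: "p \<le> r"
    using assms(1-6) by auto
  define N where "N = (\<Sum>k. \<bar>udag k\<bar> powr q)"
  have udag_r: "udag \<in> ell r"
    using assms(15) ell_mono[of q r] q0 assms(3) by auto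
  have N0: "0 \<le> N"
    using assms(15) q0 unfolding N_def by (intro suminf_nonneg) (auto simp: mem_ell_iff_summable)
  \<comment> \<open>\<open>D * \<delta> powr \<sigma>\<close> will bound the Tikhonov value of the
    truncation: the first summand comes from the residual (with \<open>+ 1\<close> for the noise),
    \<open>N\<close> from the weighted penalty.\<close>
  define D where "D = (d\<^sub>2 * N powr (1 / a) + 1) powr \<sigma> + N"
  have D0: "0 < D"
    using N0 assms(12,13) unfolding D_def
    by (intro add_pos_nonneg) (auto simp: add_nonneg_eq_0_iff)
  \<comment> \<open>\<open>B * \<delta> powr a\<close> will bound the \<open>a\<close>-th power sum
    of the error; \<open>M\<close> collects the coefficients of the three interpolation
    terms.\<close>
  define B where "B = ((D powr (1 / \<sigma>) + 1) / d\<^sub>1) powr a"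
  define M where "M = B + 2 powr p * D + 2 powr q * N"
  have main: "penalty p (u\<delta> \<delta>) \<le> ennreal (D * \<delta> powr (- \<gamma>\<^sub>2)) \<and>
      ell_norm r (\<lambda>k. u\<delta> \<delta> k - udag k) \<le> ennreal (M powr (1 / r) * \<delta> powr \<gamma>\<^sub>1)"
    if \<delta>: "\<delta> > 0" for \<delta>
  proof -
    \<comment> \<open>The height solves \<open>t powr (a - q) = \<delta> powr a\<close>, which
      brings the truncation error in the \<open>a\<close>-norm to the order of the noise.\<close>
    define t where "t = \<delta> powr (a / (a - q))"
    have t: "t > 0"
      using \<delta> by (simp add: t_def)
    have t_a: "t powr (a - q) = \<delta> powr a"
      using qa by (simp add: t_def powr_powr)
    have "a / (a - q) * (p - q) = - \<gamma>\<^sub>2"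
      using qa by (simp add: assms(22) field_simps)
    then have t_p: "t powr (p - q) = \<delta> powr (- \<gamma>\<^sub>2)"
      by (simp add: t_def powr_powr)
    have "a / (a - q) * (r - q) * (1 / r) = \<gamma>\<^sub>1"
      using qa r0 by (simp add: assms(21))
    then have t_r: "(t powr (r - q)) powr (1 / r) = \<delta> powr \<gamma>\<^sub>1"
      by (simp add: t_def powr_powr)
    \<comment> \<open>Since \<open>t powr (p - q)\<close> is the inverse of the second factor, the
      weighted penalty of the truncation has the order \<open>\<delta> powr \<sigma>\<close> of the
      residual.\<close>
    have \<alpha>: "\<alpha> \<delta> = \<delta> powr \<sigma> * \<delta> powr \<gamma>\<^sub>2"
      using assms(18)[OF \<delta>] by (simp add: assms(22) powr_add)

    \<comment> \<open>Tikhonov value of the truncation\<close>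
    define w where "w = truncate_below t udag"
    have w_p: "w \<in> ell p" and w_sum: "(\<Sum>k. \<bar>w k\<bar> powr p) \<le> \<delta> powr (- \<gamma>\<^sub>2) * N"
      using truncate_below_power_sum[OF t assms(1,2,15)] by (auto simp: w_def N_def t_p)
    have w_r: "w \<in> ell r"
      using w_p ell_mono[OF assms(1) pr] by auto
    have wu_r: "(\<lambda>k. w k - udag k) \<in> ell r"
      using w_r udag_r r0 by (intro ell_diff) auto
    have wu_a: "(\<lambda>k. w k - udag k) \<in> ell a"
      using wu_r ell_mono[of r a] r0 assms(5) by auto
    have "(\<Sum>k. \<bar>w k - udag k\<bar> powr a) powr (1 / a) \<le> (\<delta> powr a * N) powr (1 / a)"
      using truncate_below_error[OF t q0 _ assms(15), of a] qa a0 wu_a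
      by (intro powr_mono2 suminf_nonneg) (auto simp: w_def N_def t_a mem_ell_iff_summable)
    also have "\<dots> = \<delta> * N powr (1 / a)"
      using \<delta> a0 N0 by (simp add: powr_mult powr_powr)
    finally have "ell_norm a (\<lambda>k. w k - udag k) \<le> ennreal (\<delta> * N powr (1 / a))"
      using ell_norm_eq_suminf[OF a0 wu_a] by (simp add: ennreal_leI)
    then have "ennreal (norm (A (\<lambda>k. w k - udag k))) \<le> ennreal d\<^sub>2 * ennreal (\<delta> * N powr (1 / a))"
      using assms(14)[OF wu_r] by (meson mult_left_mono order_trans zero_le)
    then have "norm (A (\<lambda>k. w k - udag k)) \<le> d\<^sub>2 * (\<delta> * N powr (1 / a))"
      using assms(12,13) \<delta> by (simp flip: ennreal_mult)
    then have Aw: "norm (A w - v) \<le> d\<^sub>2 * (\<delta> * N powr (1 / a))"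
      using linear_on_ell_diff[OF assms(7) _ w_r udag_r] r0 assms(16) by simp
    have "norm (A w - v\<delta> \<delta>) \<le> norm (A w - v) + norm (v\<delta> \<delta> - v)"
      by norm
    also have "\<dots> \<le> \<delta> * (d\<^sub>2 * N powr (1 / a) + 1)"
      using Aw assms(17)[OF \<delta>] by (simp add: algebra_simps)
    finally have "norm (A w - v\<delta> \<delta>) powr \<sigma> \<le> (\<delta> * (d\<^sub>2 * N powr (1 / a) + 1)) powr \<sigma>"
      using assms(6) by (intro powr_mono2) auto
    also have "\<dots> = \<delta> powr \<sigma> * (d\<^sub>2 * N powr (1 / a) + 1) powr \<sigma>"
      using \<delta> assms(12,13) by (simp add: powr_mult)
    finally have res: "norm (A w - v\<delta> \<delta>) powr \<sigma> \<le> \<delta> powr \<sigma> * (d\<^sub>2 * N powr (1 / a) + 1) powr \<sigma>" .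
    have pen: "\<alpha> \<delta> * (\<Sum>k. \<bar>w k\<bar> powr p) \<le> \<delta> powr \<sigma> * N"
    proof -
      have "\<alpha> \<delta> * (\<Sum>k. \<bar>w k\<bar> powr p) \<le> \<alpha> \<delta> * (\<delta> powr (- \<gamma>\<^sub>2) * N)"
        using w_sum by (intro mult_left_mono) (auto simp: \<alpha>)
      then show ?thesis
        using \<delta> by (simp add: \<alpha> powr_minus field_simps)
    qed

    \<comment> \<open>On \<open>ell p\<close> the functional is the image of a real number, so
      minimality becomes a real inequality.\<close>
    have tik: "tikhonov A (v\<delta> \<delta>) \<sigma> p (\<alpha> \<delta>) x
        = ennreal (norm (A x - v\<delta> \<delta>) powr \<sigma> + \<alpha> \<delta> * (\<Sum>k. \<bar>x k\<bar> powr p))"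
      and sum_nonneg: "0 \<le> (\<Sum>k. \<bar>x k\<bar> powr p)" if x: "x \<in> ell p" for x
    proof -
      show "0 \<le> (\<Sum>k. \<bar>x k\<bar> powr p)"
        using x assms(1) by (intro suminf_nonneg) (auto simp: mem_ell_iff_summable)
      then show "tikhonov A (v\<delta> \<delta>) \<sigma> p (\<alpha> \<delta>) x
        = ennreal (norm (A x - v\<delta> \<delta>) powr \<sigma> + \<alpha> \<delta> * (\<Sum>k. \<bar>x k\<bar> powr p))"
        using penalty_eq_suminf[OF assms(1) x] \<alpha> by (simp add: tikhonov_def ennreal_mult)
    qed

    \<comment> \<open>Residual and penalty of the minimizer\<close>
    have u_p: "u\<delta> \<delta> \<in> ell p"
      using assms(19)[OF \<delta>] .
    have u_r: "u\<delta> \<delta> \<in> ell r"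
      using u_p ell_mono[OF assms(1) pr] by auto
    have "tikhonov A (v\<delta> \<delta>) \<sigma> p (\<alpha> \<delta>) (u\<delta> \<delta>) \<le> tikhonov A (v\<delta> \<delta>) \<sigma> p (\<alpha> \<delta>) w"
      using assms(20)[OF \<delta>] w_r unfolding is_arg_min_def by (meson not_le)
    also have "\<dots> \<le> ennreal (D * \<delta> powr \<sigma>)"
      using res pen tik[OF w_p] by (auto intro!: ennreal_leI simp: D_def algebra_simps)
    finally have val: "norm (A (u\<delta> \<delta>) - v\<delta> \<delta>) powr \<sigma> + \<alpha> \<delta> * (\<Sum>k. \<bar>u\<delta> \<delta> k\<bar> powr p)
        \<le> D * \<delta> powr \<sigma>"
      using D0 by (simp add: tik[OF u_p])
    \<comment> \<open>Both summands in \<open>val\<close> are nonnegative, so each one alone obeys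
      the bound.\<close>
    have u_res: "norm (A (u\<delta> \<delta>) - v\<delta> \<delta>) powr \<sigma> \<le> D * \<delta> powr \<sigma>"
      and "\<alpha> \<delta> * (\<Sum>k. \<bar>u\<delta> \<delta> k\<bar> powr p) \<le> D * \<delta> powr \<sigma>"
    proof -
      have "0 \<le> \<alpha> \<delta> * (\<Sum>k. \<bar>u\<delta> \<delta> k\<bar> powr p)"
        using sum_nonneg[OF u_p] by (simp add: \<alpha>)
      moreover have "0 \<le> norm (A (u\<delta> \<delta>) - v\<delta> \<delta>) powr \<sigma>"
        by simp
      ultimately show "norm (A (u\<delta> \<delta>) - v\<delta> \<delta>) powr \<sigma> \<le> D * \<delta> powr \<sigma>"
        and "\<alpha> \<delta> * (\<Sum>k. \<bar>u\<delta> \<delta> k\<bar> powr p) \<le> D * \<delta> powr \<sigma>"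
        using val by linarith+
    qed
    then have u_sum: "(\<Sum>k. \<bar>u\<delta> \<delta> k\<bar> powr p) \<le> D * \<delta> powr (- \<gamma>\<^sub>2)"
      using \<delta> by (simp add: \<alpha> powr_minus field_simps)

    \<comment> \<open>Error in the a-norm\<close>
    have "(norm (A (u\<delta> \<delta>) - v\<delta> \<delta>) powr \<sigma>) powr (1 / \<sigma>) \<le> (D * \<delta> powr \<sigma>) powr (1 / \<sigma>)"
      using u_res assms(6) by (intro powr_mono2) auto
    then have "norm (A (u\<delta> \<delta>) - v\<delta> \<delta>) \<le> D powr (1 / \<sigma>) * \<delta>"
      using assms(6) \<delta> D0 by (simp add: powr_powr powr_mult)
    then have Au: "norm (A (u\<delta> \<delta>) - v) \<le> (D powr (1 / \<sigma>) + 1) * \<delta>"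
      using assms(17)[OF \<delta>] norm_triangle_ineq[of "A (u\<delta> \<delta>) - v\<delta> \<delta>" "v\<delta> \<delta> - v"]
      by (simp add: algebra_simps)
    define E where "E = (\<Sum>k. \<bar>u\<delta> \<delta> k - udag k\<bar> powr a)"
    have e_r: "(\<lambda>k. u\<delta> \<delta> k - udag k) \<in> ell r"
      using u_r udag_r r0 by (intro ell_diff) auto
    have e_a: "(\<lambda>k. u\<delta> \<delta> k - udag k) \<in> ell a"
      using e_r ell_mono[of r a] r0 assms(5) by auto
    have E0: "0 \<le> E"
      using e_a a0 unfolding E_def by (intro suminf_nonneg) (auto simp: mem_ell_iff_summable)
    \<comment> \<open>The lower estimate for \<open>A\<close> acts as a stability bound: it carries
      the data error back to the \<open>a\<close>-norm.\<close>
    have "ennreal d\<^sub>1 * ennreal (E powr (1 / a)) \<le> ennreal (norm (A (\<lambda>k. u\<delta> \<delta> k - udag k)))"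
      using assms(14)[OF e_r] ell_norm_eq_suminf[OF a0 e_a] by (simp add: E_def)
    then have "d\<^sub>1 * E powr (1 / a) \<le> norm (A (u\<delta> \<delta>) - v)"
      using linear_on_ell_diff[OF assms(7) _ u_r udag_r] r0 assms(12,16)
      by (simp flip: ennreal_mult)
    with Au have "E powr (1 / a) \<le> (D powr (1 / \<sigma>) + 1) / d\<^sub>1 * \<delta>"
      using assms(12) by (simp add: field_simps)
    then have "(E powr (1 / a)) powr a \<le> ((D powr (1 / \<sigma>) + 1) / d\<^sub>1 * \<delta>) powr a"
      using a0 by (intro powr_mono2) auto
    then have E_le: "E \<le> B * t powr (a - q)"
      using a0 E0 powr_mult[of "(D powr (1 / \<sigma>) + 1) / d\<^sub>1" \<delta> a]
      by (simp add: powr_powr B_def t_a)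

    \<comment> \<open>Error in the r-norm by interpolation\<close>
    have "(\<Sum>k. \<bar>u\<delta> \<delta> k - udag k\<bar> powr r) \<le> t powr (r - a) * E
        + 2 powr p * t powr (r - p) * (\<Sum>k. \<bar>u\<delta> \<delta> k\<bar> powr p) + 2 powr q * t powr (r - q) * N"
      using power_sum_diff_split[OF t assms(1) pr q0 assms(3) _ u_p assms(15), of a] assms(5)
      by (simp add: E_def N_def)
    also have "\<dots> \<le> t powr (r - a) * (B * t powr (a - q))
        + 2 powr p * t powr (r - p) * (D * t powr (p - q)) + 2 powr q * t powr (r - q) * N"
      using E_le u_sum by (intro add_mono mult_left_mono) (auto simp: t_p)
    \<comment> \<open>With this \<open>t\<close> the three terms balance: all are multiples of
      \<open>t powr (r - q)\<close>.\<close>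
    also have "\<dots> = M * t powr (r - q)"
    proof -
      have "t powr (r - q) = t powr (r - a) * t powr (a - q)"
        "t powr (r - q) = t powr (r - p) * t powr (p - q)"
        by (simp_all flip: powr_add)
      then show ?thesis
        by (simp add: M_def algebra_simps)
    qed
    finally have "(\<Sum>k. \<bar>u\<delta> \<delta> k - udag k\<bar> powr r) powr (1 / r) \<le> (M * t powr (r - q)) powr (1 / r)"
      using e_r r0 by (intro powr_mono2 suminf_nonneg) (auto simp: mem_ell_iff_summable)
    also have "\<dots> = M powr (1 / r) * \<delta> powr \<gamma>\<^sub>1"
    proof -
      have "0 \<le> M"
        using N0 D0 by (simp add: M_def B_def)
      then show ?thesis
        by (simp add: powr_mult t_r)
    qed
    finally have "ell_norm r (\<lambda>k. u\<delta> \<delta> k - udag k) \<le> ennreal (M powr (1 / r) * \<delta> powr \<gamma>\<^sub>1)"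
      using ell_norm_eq_suminf[OF r0 e_r] by (simp add: ennreal_leI)
    moreover have "penalty p (u\<delta> \<delta>) \<le> ennreal (D * \<delta> powr (- \<gamma>\<^sub>2))"
      using penalty_eq_suminf[OF assms(1) u_p] u_sum by (simp add: ennreal_leI)
    ultimately show ?thesis
      by blast
  qed
  \<comment> \<open>\<open>enn2real\<close> sends \<open>top\<close> to 0 and is monotone only below
    a finite bound, which \<open>ennreal (c * \<delta> powr \<gamma>)\<close> supplies.\<close>
  have bigo: "(\<lambda>\<delta>. enn2real (f \<delta>)) \<in> O[at_right 0](\<lambda>\<delta>. \<delta> powr \<gamma>)"
    if "\<And>\<delta>. \<delta> > 0 \<Longrightarrow> f \<delta> \<le> ennreal (c * \<delta> powr \<gamma>)" "0 \<le> c" for f c \<gamma>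
  proof (rule bigoI)
    show "\<forall>\<^sub>F \<delta> in at_right 0. norm (enn2real (f \<delta>)) \<le> c * norm (\<delta> powr \<gamma>)"
      using eventually_at_right_less[of 0]
    proof eventually_elim
      case (elim \<delta>)
      then show ?case
        using enn2real_mono[OF that(1)[of \<delta>]] that(2) by simp
    qed
  qed
  show ?thesis
    using bigo[of "\<lambda>\<delta>. ell_norm r (\<lambda>k. u\<delta> \<delta> k - udag k)" "M powr (1 / r)" \<gamma>\<^sub>1]
      bigo[of "\<lambda>\<delta>. penalty p (u\<delta> \<delta>)" D "- \<gamma>\<^sub>2"] main D0
    by simp
qed

end
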